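(* Let $A$ be a vector space over a field $k$ with dual $A^{*}$, and let $\lambda\in k$. Let $(A,R)$ and $(A^{*},-\lambda I-R^{*})$ be Rota-Baxter 3-Lie algebras of weight $\lambda$, where $I$ is the identity of $A^{*}$ and $R^{*}:A^{*}\to A^{*}$ is the transpose of $R$. Define the bilinear form $B$ on $A\oplus A^{*}$ by $$B(x+\xi,y+\eta)=\langle x,\eta\rangle+\langle \xi,y\rangle ,\qquad x,y\in A,\ \xi,\eta\in A^{*}.$$ Then $(A\oplus A^{*},B,A,A^{*})$ is a Manin triple of Rota-Baxter 3-Lie algebras (that is, there is a Rota-Baxter 3-Lie algebra structure of weight $\lambda$ on $A\oplus A^{*}$ which, with the form $B$ and the Rota-Baxter 3-Lie algebras $(A,R)$ and $(A^{*},-\lambda I-R^{*})$, is a Manin triple) if and only if $(A,A^{*},ad^{*},\mathfrak{ad}^{*},R,-\lambda I-R^{*})$ is a matched pair of Rota-Baxter 3-Lie algebras, i.e. the matched pair with $\rho=ad^{*}$, $\varrho=\mathfrak{ad}^{*}$, $R_A=R$ and $R_{A^{*}}=-\lambda I-R^{*}$.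
   Context: A 3-Lie algebra is a vector space $A$ with a skew-symmetric linear map $[\cdot,\cdot,\cdot]:\wedge^3A\to A$ satisfying $[x_1,x_2,[y_1,y_2,y_3]]=[[x_1,x_2,y_1],y_2,y_3]+[y_1,[x_1,x_2,y_2],y_3]+[y_1,y_2,[x_1,x_2,y_3]]$. A Rota-Baxter operator of weight $\lambda$ on $A$ is a linear map $R:A\to A$ with $$[Rx,Ry,Rz]=R\big([Rx,Ry,z]+[Rx,y,Rz]+[x,Ry,Rz]+\lambda([Rx,y,z]+[x,Ry,z]+[x,y,Rz])+\lambda^2[x,y,z]\big);$$ then $(A,R)$ is called a Rota-Baxter 3-Lie algebra of weight $\lambda$. A representation of a 3-Lie algebra $A$ is a vector space $V$ with a skew-symmetric bilinear map $\rho:A\wedge A\to\mathfrak{gl}(V)$ such that $\rho(x_1,x_2)\rho(x_3,x_4)-\rho(x_3,x_4)\rho(x_1,x_2)=\rho([x_1,x_2,x_3],x_4)-\rho([x_1,x_2,x_4],x_3)$ and $\rho([x_1,x_2,x_3],x_4)=\rho(x_1,x_2)\rho(x_3,x_4)+\rho(x_2,x_3)\rho(x_1,x_4)+\rho(x_3,x_1)\rho(x_2,x_4)$. A representation of a Rota-Baxter 3-Lie algebra $(A,R)$ of weight $\lambda$ is a triple $(V,R_V,\rho)$, where $(V,\rho)$ is a representation of $A$ and $R_V:V\to V$ is linear with $$\rho(Rx_1,Rx_2)R_V=R_V\rho(Rx_1,Rx_2)+R_V\big(\rho(Rx_1,x_2)+\rho(x_1,Rx_2)+\lambda\rho(x_1,x_2)\big)R_V+\lambda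 R_V\big(\rho(Rx_1,x_2)+\rho(x_1,Rx_2)+\lambda\rho(x_1,x_2)\big).$$ Coadjoint maps: $ad^{*}:\wedge^2A\to\mathfrak{gl}(A^{*})$ is given by $\langle ad^{*}(x,y)\xi,z\rangle=-\langle\xi,[x,y,z]\rangle$, and $\mathfrak{ad}^{*}$ is the analogous map for the 3-Lie algebra $A^{*}$, regarded as acting on $A$, i.e. $\mathfrak{ad}^{*}:\wedge^2A^{*}\to\mathfrak{gl}(A)$ with $\langle \mathfrak{ad}^{*}(\xi,\eta)x,\zeta\rangle=-\langle x,[\xi,\eta,\zeta]_{A^{*}}\rangle$. Matched pairs: let $A,B$ be 3-Lie algebras, $(B,\rho)$ a representation of $A$ and $(A,\varrho)$ a representation of $B$. $(A,B,\rho,\varrho)$ is a matched pair of 3-Lie algebras if $A\oplus B$ with the bracket $$[x+a,y+b,z+c]=[x,y,z]+\varrho(a,b)z+\varrho(b,c)x+\varrho(c,a)y+[a,b,c]+\rho(x,y)c+\rho(y,z)a+\rho(z,x)b$$ ($x,y,z\in A$, $a,b,c\in B$) is a 3-Lie algebra, denoted $A\bowtie B$. If $(A,R_A)$, $(B,R_B)$ are Rota-Baxter 3-Lie algebras of weight $\lambda$, then $(A,B,R_A,R_B,\rho,\varrho)$ is a matched pair of Rota-Baxter 3-Lie algebras if $(B,R_B,\rho)$ is a representation of $(A,R_A)$, $(A,R_A,\varrho)$ is a representation of $(B,R_B)$, and $(A,B,\rho,\varrho)$ is a matched pair of 3-Lie algebras; then $(A\bowtie B,R_A+R_B)$, with $(R_A+R_B)(x+a)=R_A(x)+R_B(a)$,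 is a Rota-Baxter 3-Lie algebra. A bilinear form $B$ on a Rota-Baxter 3-Lie algebra $(A,R)$ of weight $\lambda$ is invariant if $B([x_1,x_2,x_3],x_4)+B([x_1,x_2,x_4],x_3)=0$ and $B(Rx,y)+B(x,Ry)+\lambda B(x,y)=0$ for all elements. $(A,R)$ is pseudo-metric if there is a nondegenerate symmetric invariant bilinear form on it. A Manin triple of Rota-Baxter 3-Lie algebras of weight $\lambda$ consists of a pseudo-metric Rota-Baxter 3-Lie algebra $(\mathcal A,R)$ and Rota-Baxter 3-Lie algebras $(A_1,R_1)$, $(A_2,R_2)$ such that (i) $(A_1,R_1)$ and $(A_2,R_2)$ are Rota-Baxter 3-Lie subalgebras of $(\mathcal A,R)$ (so $R|_{A_i}=R_i$); (ii) $\mathcal A=A_1\oplus A_2$ as vector spaces; (iii) for all $x_1,x_2\in A_1$, $a_1,a_2\in A_2$, $P_1[x_1,x_2,a_1]=0$ and $P_2[a_1,a_2,x_1]=0$, where $P_1,P_2$ are the projections of $A_1\oplus A_2$ onto $A_1,A_2$. *)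

theory Defs
  imports
    "HOL-Analysis.Product_Vector"
    "HOL-Library.Function_Algebras"
begin

text \<open>
  Algebras live on a linear subspace (the carrier) of a type that is a vector space for an explicit
  scalar multiplication \<open>s\<close>.  All conditions concern elements of the carrier only; the values
  of brackets, operators and actions outside of it are irrelevant.  The letter \<open>w\<close> denotes the weight.
\<close>

definition linear_map_on ::
  "('k::field \<Rightarrow> 'v::ab_group_add \<Rightarrow> 'v) \<Rightarrow> 'v set \<Rightarrow>
   ('k \<Rightarrow> 'w::ab_group_add \<Rightarrow> 'w) \<Rightarrow> 'w set \<Rightarrow> ('v \<Rightarrow> 'w) \<Rightarrow> bool"
  where "linear_map_on s V t W f \<longleftrightarrow>
    (\<forall>x\<in>V. f x \<in> W) \<and>
    (\<forall>x\<in>V. \<forall>y\<in>V. f (x + y) = f x + f y) \<and>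
    (\<forall>c. \<forall>x\<in>V. f (s c x) = t c (f x))"

section \<open>Rota-Baxter 3-Lie algebras\<close>

text \<open>
  A skew-symmetric map on an exterior power is read as an alternating one, which is the meaning of
  a linear map defined on the exterior power over every field, including characteristic 2.
\<close>

locale three_lie_algebra = vector_space s
  for s :: "'k::field \<Rightarrow> 'v::ab_group_add \<Rightarrow> 'v" +
  fixes A :: "'v set" and br :: "'v \<Rightarrow> 'v \<Rightarrow> 'v \<Rightarrow> 'v"
  assumes subspace_carrier: "subspace A"
    and bracket_linear:
      "\<lbrakk>x \<in> A; y \<in> A\<rbrakk> \<Longrightarrow> linear_map_on s A s A (\<lambda>z. br z x y)"
      "\<lbrakk>x \<in> A; y \<in> A\<rbrakk> \<Longrightarrow> linear_map_on s A s A (\<lambda>z. br x z y)"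
      "\<lbrakk>x \<in> A; y \<in> A\<rbrakk> \<Longrightarrow> linear_map_on s A s A (\<lambda>z. br x y z)"
    and bracket_alternating:
      "\<lbrakk>x \<in> A; y \<in> A\<rbrakk> \<Longrightarrow> br x x y = 0"
      "\<lbrakk>x \<in> A; y \<in> A\<rbrakk> \<Longrightarrow> br x y x = 0"
      "\<lbrakk>x \<in> A; y \<in> A\<rbrakk> \<Longrightarrow> br y x x = 0"
    and fundamental_identity:
      "\<lbrakk>x\<^sub>1 \<in> A; x\<^sub>2 \<in> A; y\<^sub>1 \<in> A; y\<^sub>2 \<in> A; y\<^sub>3 \<in> A\<rbrakk> \<Longrightarrow>
        br x\<^sub>1 x\<^sub>2 (br y\<^sub>1 y\<^sub>2 y\<^sub>3)
        = br (br x\<^sub>1 x\<^sub>2 y\<^sub>1) y\<^sub>2 y\<^sub>3 + br y\<^sub>1 (br x\<^sub>1 x\<^sub>2 y\<^sub>2) y\<^sub>3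
          + br y\<^sub>1 y\<^sub>2 (br x\<^sub>1 x\<^sub>2 y\<^sub>3)"

locale rota_baxter_3_lie = three_lie_algebra s A br
  for s :: "'k::field \<Rightarrow> 'v::ab_group_add \<Rightarrow> 'v" and A br +
  fixes w :: 'k and R :: "'v \<Rightarrow> 'v"
  assumes R_linear: "linear_map_on s A s A R"
    and rota_baxter:
      "\<lbrakk>x \<in> A; y \<in> A; z \<in> A\<rbrakk> \<Longrightarrow>
        br (R x) (R y) (R z)
        = R (br (R x) (R y) z + br (R x) y (R z) + br x (R y) (R z)
             + s w (br (R x) y z + br x (R y) z + br x y (R z))
             + s (w\<^sup>2) (br x y z))"

section \<open>Representations\<close>

locale three_lie_representation =
  A: three_lie_algebra sA A br + V: vector_space sV
  for sA :: "'k::field \<Rightarrow> 'a::ab_group_add \<Rightarrow> 'a" and A br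
    and sV :: "'k \<Rightarrow> 'v::ab_group_add \<Rightarrow> 'v" +
  fixes V :: "'v set" and \<rho> :: "'a \<Rightarrow> 'a \<Rightarrow> 'v \<Rightarrow> 'v"
  assumes subspace_V: "V.subspace V"
    and action_linear: "\<lbrakk>x \<in> A; y \<in> A\<rbrakk> \<Longrightarrow> linear_map_on sV V sV V (\<rho> x y)"
    and action_bilinear:
      "\<lbrakk>y \<in> A; v \<in> V\<rbrakk> \<Longrightarrow> linear_map_on sA A sV V (\<lambda>x. \<rho> x y v)"
      "\<lbrakk>x \<in> A; v \<in> V\<rbrakk> \<Longrightarrow> linear_map_on sA A sV V (\<lambda>y. \<rho> x y v)"
    and action_alternating: "\<lbrakk>x \<in> A; v \<in> V\<rbrakk> \<Longrightarrow> \<rho> x x v = 0"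
    and action_commutator:
      "\<lbrakk>x\<^sub>1 \<in> A; x\<^sub>2 \<in> A; x\<^sub>3 \<in> A; x\<^sub>4 \<in> A; v \<in> V\<rbrakk> \<Longrightarrow>
        \<rho> x\<^sub>1 x\<^sub>2 (\<rho> x\<^sub>3 x\<^sub>4 v) - \<rho> x\<^sub>3 x\<^sub>4 (\<rho> x\<^sub>1 x\<^sub>2 v)
        = \<rho> (br x\<^sub>1 x\<^sub>2 x\<^sub>3) x\<^sub>4 v - \<rho> (br x\<^sub>1 x\<^sub>2 x\<^sub>4) x\<^sub>3 v"
    and action_bracket:
      "\<lbrakk>x\<^sub>1 \<in> A; x\<^sub>2 \<in> A; x\<^sub>3 \<in> A; x\<^sub>4 \<in> A; v \<in> V\<rbrakk> \<Longrightarrow>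
        \<rho> (br x\<^sub>1 x\<^sub>2 x\<^sub>3) x\<^sub>4 v
        = \<rho> x\<^sub>1 x\<^sub>2 (\<rho> x\<^sub>3 x\<^sub>4 v) + \<rho> x\<^sub>2 x\<^sub>3 (\<rho> x\<^sub>1 x\<^sub>4 v) + \<rho> x\<^sub>3 x\<^sub>1 (\<rho> x\<^sub>2 x\<^sub>4 v)"

locale rota_baxter_representation =
  rota_baxter_3_lie sA A br w R + three_lie_representation sA A br sV V \<rho>
  for sA :: "'k::field \<Rightarrow> 'a::ab_group_add \<Rightarrow> 'a" and A br w R
    and sV :: "'k \<Rightarrow> 'v::ab_group_add \<Rightarrow> 'v" and V \<rho> +
  fixes R\<^sub>V :: "'v \<Rightarrow> 'v"
  assumes R\<^sub>V_linear: "linear_map_on sV V sV V R\<^sub>V"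
    and rota_baxter_action:
      "\<lbrakk>x\<^sub>1 \<in> A; x\<^sub>2 \<in> A; v \<in> V\<rbrakk> \<Longrightarrow>
        \<rho> (R x\<^sub>1) (R x\<^sub>2) (R\<^sub>V v)
        = R\<^sub>V (\<rho> (R x\<^sub>1) (R x\<^sub>2) v)
          + R\<^sub>V (\<rho> (R x\<^sub>1) x\<^sub>2 (R\<^sub>V v) + \<rho> x\<^sub>1 (R x\<^sub>2) (R\<^sub>V v) + sV w (\<rho> x\<^sub>1 x\<^sub>2 (R\<^sub>V v)))
          + sV w (R\<^sub>V (\<rho> (R x\<^sub>1) x\<^sub>2 v + \<rho> x\<^sub>1 (R x\<^sub>2) v + sV w (\<rho> x\<^sub>1 x\<^sub>2 v)))"

section \<open>Matched pairs\<close>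

text \<open>The direct sum of \<open>A\<close> and \<open>B\<close> is \<open>A \<times> B\<close>; the pair \<open>(x, a)\<close> stands for \<open>x + a\<close>.\<close>

definition matched_bracket ::
  "('a::ab_group_add \<Rightarrow> 'a \<Rightarrow> 'a \<Rightarrow> 'a) \<Rightarrow> ('b::ab_group_add \<Rightarrow> 'b \<Rightarrow> 'b \<Rightarrow> 'b) \<Rightarrow>
   ('a \<Rightarrow> 'a \<Rightarrow> 'b \<Rightarrow> 'b) \<Rightarrow> ('b \<Rightarrow> 'b \<Rightarrow> 'a \<Rightarrow> 'a) \<Rightarrow>
   'a \<times> 'b \<Rightarrow> 'a \<times> 'b \<Rightarrow> 'a \<times> 'b \<Rightarrow> 'a \<times> 'b"
  where "matched_bracket brA brB \<rho> \<phi> = (\<lambda>(x, a) (y, b) (z, c).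
    (brA x y z + \<phi> a b z + \<phi> b c x + \<phi> c a y,
     brB a b c + \<rho> x y c + \<rho> y z a + \<rho> z x b))"

locale matched_pair_3_lie =
  repA: three_lie_representation sA A brA sB B \<rho> +
  repB: three_lie_representation sB B brB sA A \<phi>
  for sA :: "'k::field \<Rightarrow> 'a::ab_group_add \<Rightarrow> 'a" and A brA
    and sB :: "'k \<Rightarrow> 'b::ab_group_add \<Rightarrow> 'b" and B brB \<rho> \<phi> +
  assumes matched_three_lie:
    "three_lie_algebra (module_prod.scale sA sB) (A \<times> B) (matched_bracket brA brB \<rho> \<phi>)"

locale matched_pair_rota_baxter =
  repA: rota_baxter_representation sA A brA w R\<^sub>A sB B \<rho> R\<^sub>B +
  repB: rota_baxter_representation sB B brB w R\<^sub>B sA A \<phi> R\<^sub>A +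
  matched_pair_3_lie sA A brA sB B brB \<rho> \<phi>
  for sA :: "'k::field \<Rightarrow> 'a::ab_group_add \<Rightarrow> 'a" and A brA
    and sB :: "'k \<Rightarrow> 'b::ab_group_add \<Rightarrow> 'b" and B brB w R\<^sub>A R\<^sub>B \<rho> \<phi>

section \<open>Manin triples\<close>

definition pseudo_metric_form ::
  "('k::field \<Rightarrow> 'v::ab_group_add \<Rightarrow> 'v) \<Rightarrow> 'v set \<Rightarrow> ('v \<Rightarrow> 'v \<Rightarrow> 'v \<Rightarrow> 'v) \<Rightarrow>
   'k \<Rightarrow> ('v \<Rightarrow> 'v) \<Rightarrow> ('v \<Rightarrow> 'v \<Rightarrow> 'k) \<Rightarrow> bool"
  where "pseudo_metric_form s M br w R Bf \<longleftrightarrow>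
    (\<forall>y\<in>M. linear_map_on s M (*) UNIV (\<lambda>x. Bf x y) \<and> linear_map_on s M (*) UNIV (Bf y)) \<and>
    (\<forall>x\<in>M. \<forall>y\<in>M. Bf x y = Bf y x) \<and>
    (\<comment> \<open>by symmetry the left and right radicals agree\<close>
      \<forall>x\<in>M. (\<forall>y\<in>M. Bf x y = 0) \<longrightarrow> x = 0) \<and>
    (\<forall>x\<^sub>1\<in>M. \<forall>x\<^sub>2\<in>M. \<forall>x\<^sub>3\<in>M. \<forall>x\<^sub>4\<in>M. Bf (br x\<^sub>1 x\<^sub>2 x\<^sub>3) x\<^sub>4 + Bf (br x\<^sub>1 x\<^sub>2 x\<^sub>4) x\<^sub>3 = 0) \<and>
    (\<forall>x\<in>M. \<forall>y\<in>M. Bf (R x) y + Bf x (R y) + w * Bf x y = 0)"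

definition rota_baxter_subalgebra ::
  "'v set \<Rightarrow> ('v \<Rightarrow> 'v \<Rightarrow> 'v \<Rightarrow> 'v) \<Rightarrow> ('v \<Rightarrow> 'v) \<Rightarrow>
   'v set \<Rightarrow> ('v \<Rightarrow> 'v \<Rightarrow> 'v \<Rightarrow> 'v) \<Rightarrow> ('v \<Rightarrow> 'v) \<Rightarrow> bool"
  where "rota_baxter_subalgebra A br\<^sub>A R\<^sub>A M br R \<longleftrightarrow>
    A \<subseteq> M \<and>
    (\<forall>x\<in>A. \<forall>y\<in>A. \<forall>z\<in>A. br x y z = br\<^sub>A x y z) \<and>
    (\<forall>x\<in>A. R x = R\<^sub>A x)"

definition direct_sum_decomp :: "'v::ab_group_add set \<Rightarrow> 'v set \<Rightarrow> 'v set \<Rightarrow> bool"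
  where "direct_sum_decomp M A\<^sub>1 A\<^sub>2 \<longleftrightarrow> M = {x + a |x a. x \<in> A\<^sub>1 \<and> a \<in> A\<^sub>2} \<and> A\<^sub>1 \<inter> A\<^sub>2 = {0}"

definition proj_along :: "'v::ab_group_add set \<Rightarrow> 'v set \<Rightarrow> 'v \<Rightarrow> 'v"
  where "proj_along A\<^sub>1 A\<^sub>2 v = (THE x. x \<in> A\<^sub>1 \<and> (\<exists>a\<in>A\<^sub>2. v = x + a))"

definition manin_triple ::
  "('k::field \<Rightarrow> 'v::ab_group_add \<Rightarrow> 'v) \<Rightarrow> 'k \<Rightarrow>
   'v set \<Rightarrow> ('v \<Rightarrow> 'v \<Rightarrow> 'v \<Rightarrow> 'v) \<Rightarrow> ('v \<Rightarrow> 'v) \<Rightarrow> ('v \<Rightarrow> 'v \<Rightarrow> 'k) \<Rightarrow>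
   'v set \<Rightarrow> ('v \<Rightarrow> 'v \<Rightarrow> 'v \<Rightarrow> 'v) \<Rightarrow> ('v \<Rightarrow> 'v) \<Rightarrow>
   'v set \<Rightarrow> ('v \<Rightarrow> 'v \<Rightarrow> 'v \<Rightarrow> 'v) \<Rightarrow> ('v \<Rightarrow> 'v) \<Rightarrow> bool"
  where "manin_triple s w M br R Bf A\<^sub>1 br\<^sub>1 R\<^sub>1 A\<^sub>2 br\<^sub>2 R\<^sub>2 \<longleftrightarrow>
    rota_baxter_3_lie s M br w R \<and> pseudo_metric_form s M br w R Bf \<and>
    rota_baxter_3_lie s A\<^sub>1 br\<^sub>1 w R\<^sub>1 \<and> rota_baxter_3_lie s A\<^sub>2 br\<^sub>2 w R\<^sub>2 \<and>
    rota_baxter_subalgebra A\<^sub>1 br\<^sub>1 R\<^sub>1 M br R \<and> rota_baxter_subalgebra A\<^sub>2 br\<^sub>2 R\<^sub>2 M br R \<and>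
    direct_sum_decomp M A\<^sub>1 A\<^sub>2 \<and>
    (\<forall>x\<^sub>1\<in>A\<^sub>1. \<forall>x\<^sub>2\<in>A\<^sub>1. \<forall>a\<in>A\<^sub>2. proj_along A\<^sub>1 A\<^sub>2 (br x\<^sub>1 x\<^sub>2 a) = 0) \<and>
    (\<forall>a\<^sub>1\<in>A\<^sub>2. \<forall>a\<^sub>2\<in>A\<^sub>2. \<forall>x\<in>A\<^sub>1. proj_along A\<^sub>2 A\<^sub>1 (br a\<^sub>1 a\<^sub>2 x) = 0)"

section \<open>The dual space and the coadjoint maps\<close>

text \<open>
  The dual of a vector space with underlying type \<open>'a\<close> is a subspace of the function space
  \<open>'a \<Rightarrow> 'k\<close> with pointwise operations.
\<close>

definition fun_scale :: "'k::field \<Rightarrow> ('a \<Rightarrow> 'k) \<Rightarrow> 'a \<Rightarrow> 'k"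
  where "fun_scale c f = (\<lambda>x. c * f x)"

definition dual_space :: "('k::field \<Rightarrow> 'a::ab_group_add \<Rightarrow> 'a) \<Rightarrow> ('a \<Rightarrow> 'k) set"
  where "dual_space s = {\<xi>. Vector_Spaces.linear s (*) \<xi>}"

definition transpose_map :: "('a \<Rightarrow> 'a) \<Rightarrow> ('a \<Rightarrow> 'k) \<Rightarrow> 'a \<Rightarrow> 'k"
  where "transpose_map R \<xi> = \<xi> \<circ> R"

definition dual_operator :: "'k::field \<Rightarrow> ('a \<Rightarrow> 'a) \<Rightarrow> ('a \<Rightarrow> 'k) \<Rightarrow> 'a \<Rightarrow> 'k"
  where "dual_operator w R \<xi> = fun_scale (- w) \<xi> - transpose_map R \<xi>"

definition coadjoint :: "('a \<Rightarrow> 'a \<Rightarrow> 'a \<Rightarrow> 'a) \<Rightarrow> 'a \<Rightarrow> 'a \<Rightarrow> ('a \<Rightarrow> 'k::field) \<Rightarrow> 'a \<Rightarrow> 'k"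
  where "coadjoint br x y \<xi> = (\<lambda>z. - \<xi> (br x y z))"

text \<open>
  The coadjoint map of a bracket \<open>br'\<close> on the dual, regarded as acting on \<open>A\<close> itself rather
  than on the double dual.  The condition determines \<open>\<phi>\<close> on the dual space
  (\<open>coadjoint_on_predual_unique\<close>).  Such a \<open>\<phi>\<close> always exists in finite dimension
  (\<open>coadjoint_on_predual_exists\<close>); in general its existence is a condition on \<open>br'\<close>.
\<close>

definition coadjoint_on_predual ::
  "('k::field \<Rightarrow> 'a::ab_group_add \<Rightarrow> 'a) \<Rightarrow>
   (('a \<Rightarrow> 'k) \<Rightarrow> ('a \<Rightarrow> 'k) \<Rightarrow> ('a \<Rightarrow> 'k) \<Rightarrow> 'a \<Rightarrow> 'k) \<Rightarrow>
   (('a \<Rightarrow> 'k) \<Rightarrow> ('a \<Rightarrow> 'k) \<Rightarrow> 'a \<Rightarrow> 'a) \<Rightarrow> bool"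
  where "coadjoint_on_predual s br' \<phi> \<longleftrightarrow>
    (\<forall>\<xi>\<in>dual_space s. \<forall>\<eta>\<in>dual_space s. \<forall>\<zeta>\<in>dual_space s. \<forall>x. \<zeta> (\<phi> \<xi> \<eta> x) = - br' \<xi> \<eta> \<zeta> x)"

lemma vector_space_mult: "vector_space ((*) :: 'k::field \<Rightarrow> 'k \<Rightarrow> 'k)"
  by unfold_locales (simp_all add: algebra_simps)

lemma sum_fun_apply: "(\<Sum>b\<in>C. f b) x = (\<Sum>b\<in>C. f b (x :: 'a) :: 'k::comm_monoid_add)"
  by (induction C rule: infinite_finite_induct) simp_all

lemma dual_separates:
  fixes s :: "'k::field \<Rightarrow> 'a::ab_group_add \<Rightarrow> 'a"
  assumes "vector_space s" and eq: "\<And>\<zeta>. \<zeta> \<in> dual_space s \<Longrightarrow> \<zeta> x = \<zeta> y"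
  shows "x = y"
proof (rule ccontr)
  assume "x \<noteq> y"
  interpret vector_space_pair s "(*) :: 'k \<Rightarrow> 'k \<Rightarrow> 'k"
    using assms(1) vector_space_mult by (rule vector_space_pair.intro)
  have ind: "vs1.independent {x - y}"
    using \<open>x \<noteq> y\<close> by simp
  obtain g where g: "Vector_Spaces.linear s (*) g" "g (x - y) = 1"
    using linear_construct[OF ind, of "\<lambda>_. 1"] construct_basis[OF ind, of "x - y" "\<lambda>_. 1"] by auto
  then have "g x = g y"
    using eq by (simp add: dual_space_def)
  moreover have "g (x - y) = g x - g y"
    using linear_diff[OF g(1)] .
  ultimately show False
    using g(2) by simp
qed

lemma coadjoint_on_predual_unique:
  assumes "vector_space s"
    and "coadjoint_on_predual s br' \<phi>" and "coadjoint_on_predual s br' \<phi>'"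
    and "\<xi> \<in> dual_space s" and "\<eta> \<in> dual_space s"
  shows "\<phi> \<xi> \<eta> x = \<phi>' \<xi> \<eta> x"
proof (rule dual_separates[OF assms(1)])
  fix \<zeta> assume "\<zeta> \<in> dual_space s"
  then have "\<zeta> (\<phi> \<xi> \<eta> x) = - br' \<xi> \<eta> \<zeta> x" "\<zeta> (\<phi>' \<xi> \<eta> x) = - br' \<xi> \<eta> \<zeta> x"
    using assms(2-5) unfolding coadjoint_on_predual_def by blast+
  then show "\<zeta> (\<phi> \<xi> \<eta> x) = \<zeta> (\<phi>' \<xi> \<eta> x)" by simp
qed

lemma coadjoint_on_predual_exists:
  fixes s :: "'k::field \<Rightarrow> 'a::ab_group_add \<Rightarrow> 'a"
  assumes "finite_dimensional_vector_space s Basis"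
    and "three_lie_algebra fun_scale (dual_space s) br'"
  shows "\<exists>\<phi>. coadjoint_on_predual s br' \<phi>"
proof -
  interpret finite_dimensional_vector_space s Basis by (rule assms(1))
  interpret K: vector_space "(*) :: 'k \<Rightarrow> 'k \<Rightarrow> 'k" by (rule vector_space_mult)
  interpret D: three_lie_algebra fun_scale "dual_space s" br' by (rule assms(2))
  let ?e = "\<lambda>b v. representation Basis v b"
  have rep: "v = (\<Sum>b\<in>Basis. s (?e b v) b)" for v
    using sum_representation_eq[OF independent_Basis, of v Basis] finite_Basis span_Basis by simp
  have e: "?e b \<in> dual_space s" for b
    unfolding dual_space_def mem_Collect_eq
    by unfold_locales
      (simp_all add: representation_add representation_scale independent_Basis span_Basis)
  have sum_dual: "(\<Sum>b\<in>C. f b) \<in> dual_space s" if "\<And>b. b \<in> C \<Longrightarrow> f b \<in> dual_space s" for f and C :: "'a set"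
    using D.subspace_sum[OF D.subspace_carrier] that by blast
  define \<phi> where "\<phi> \<xi> \<eta> x = (\<Sum>b\<in>Basis. s (- br' \<xi> \<eta> (?e b) x) b)" for \<xi> \<eta> x
  have "\<zeta> (\<phi> \<xi> \<eta> x) = - br' \<xi> \<eta> \<zeta> x"
    if \<xi>: "\<xi> \<in> dual_space s" and \<eta>: "\<eta> \<in> dual_space s" and \<zeta>: "\<zeta> \<in> dual_space s" for \<xi> \<eta> \<zeta> x
  proof -
    interpret Z: Vector_Spaces.linear s "(*)" \<zeta> using \<zeta> by (simp add: dual_space_def)
    have \<zeta>_eq: "\<zeta> = (\<Sum>b\<in>Basis. fun_scale (\<zeta> b) (?e b))"
    proof
      fix v
      have "\<zeta> v = (\<Sum>b\<in>Basis. \<zeta> (s (?e b v) b))"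
        by (subst rep[of v]) (rule Z.sum)
      then show "\<zeta> v = (\<Sum>b\<in>Basis. fun_scale (\<zeta> b) (?e b)) v"
        by (simp add: Z.scale fun_scale_def mult.commute sum_fun_apply)
    qed
    have lin: "linear_map_on fun_scale (dual_space s) fun_scale (dual_space s) (br' \<xi> \<eta>)"
      using D.bracket_linear(3)[OF \<xi> \<eta>] .
    have sc: "fun_scale c f \<in> dual_space s" if "f \<in> dual_space s" for c f
      using D.subspace_scale[OF D.subspace_carrier that] .
    have zero: "br' \<xi> \<eta> 0 = 0"
    proof -
      have "0 \<in> dual_space s" using D.subspace_0[OF D.subspace_carrier] .
      then have "br' \<xi> \<eta> (0 + 0) = br' \<xi> \<eta> 0 + br' \<xi> \<eta> 0"
        using lin unfolding linear_map_on_def by blast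
      then show ?thesis by simp
    qed
    have "finite C \<Longrightarrow> br' \<xi> \<eta> (\<Sum>b\<in>C. fun_scale (\<zeta> b) (?e b))
        = (\<Sum>b\<in>C. fun_scale (\<zeta> b) (br' \<xi> \<eta> (?e b)))" for C
    proof (induction C rule: finite_induct)
      case empty
      show ?case by (simp only: sum.empty zero)
    next
      case (insert b C)
      have "(\<Sum>b\<in>C. fun_scale (\<zeta> b) (?e b)) \<in> dual_space s"
        by (rule sum_dual) (rule sc[OF e])
      then have "br' \<xi> \<eta> (fun_scale (\<zeta> b) (?e b) + (\<Sum>b\<in>C. fun_scale (\<zeta> b) (?e b)))
          = fun_scale (\<zeta> b) (br' \<xi> \<eta> (?e b)) + br' \<xi> \<eta> (\<Sum>b\<in>C. fun_scale (\<zeta> b) (?e b))"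
        using lin e[of b] sc[OF e, of "\<zeta> b" b] by (simp only: linear_map_on_def)
      then show ?case
        by (simp only: sum.insert[OF insert.hyps] insert.IH)
    qed
    from this[OF finite_Basis]
    have "br' \<xi> \<eta> \<zeta> = (\<Sum>b\<in>Basis. fun_scale (\<zeta> b) (br' \<xi> \<eta> (?e b)))"
      by (simp only: \<zeta>_eq[symmetric])
    then have "br' \<xi> \<eta> \<zeta> x = (\<Sum>b\<in>Basis. \<zeta> b * br' \<xi> \<eta> (?e b) x)"
      by (simp add: fun_scale_def sum_fun_apply)
    then show ?thesis
      unfolding \<phi>_def by (simp add: Z.sum Z.scale Z.neg sum_negf mult.commute)
  qed
  then show ?thesis
    unfolding coadjoint_on_predual_def by blast
qed

section \<open>The direct sum of a space and its dual\<close>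

text \<open>
  \<open>A\<close> and its dual sit in the direct sum as \<open>UNIV \<times> {0}\<close> and \<open>{0} \<times> dual_space s\<close>, with brackets
  and operators transported along \<open>x \<mapsto> (x, 0)\<close> and \<open>\<xi> \<mapsto> (0, \<xi>)\<close>.
\<close>

definition left_bracket ::
  "('a \<Rightarrow> 'a \<Rightarrow> 'a \<Rightarrow> 'a) \<Rightarrow> 'a \<times> 'b::zero \<Rightarrow> 'a \<times> 'b \<Rightarrow> 'a \<times> 'b \<Rightarrow> 'a \<times> 'b"
  where "left_bracket br u v w = (br (fst u) (fst v) (fst w), 0)"

definition left_operator :: "('a \<Rightarrow> 'a) \<Rightarrow> 'a \<times> 'b::zero \<Rightarrow> 'a \<times> 'b"
  where "left_operator R u = (R (fst u), 0)"

definition right_bracket ::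
  "('b \<Rightarrow> 'b \<Rightarrow> 'b \<Rightarrow> 'b) \<Rightarrow> 'a::zero \<times> 'b \<Rightarrow> 'a \<times> 'b \<Rightarrow> 'a \<times> 'b \<Rightarrow> 'a \<times> 'b"
  where "right_bracket br u v w = (0, br (snd u) (snd v) (snd w))"

definition right_operator :: "('b \<Rightarrow> 'b) \<Rightarrow> 'a::zero \<times> 'b \<Rightarrow> 'a \<times> 'b"
  where "right_operator R u = (0, R (snd u))"

definition dual_pairing_form :: "'a \<times> ('a \<Rightarrow> 'k::field) \<Rightarrow> 'a \<times> ('a \<Rightarrow> 'k) \<Rightarrow> 'k"
  where "dual_pairing_form = (\<lambda>(x, \<xi>) (y, \<eta>). \<eta> x + \<xi> y)"

end

theory Submission
  imports Defs
begin

text \<open>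
  The two sides of the equivalence describe the same bracket on \<open>A \<oplus> A\<^sup>*\<close>.

  From a Manin triple to a matched pair: invariance of the pairing \<open>B\<close> leaves no freedom in the
  mixed brackets.  By the projection condition \<open>[x, y, \<xi>]\<close> lies in \<open>A\<^sup>*\<close>, and it is determined there
  by \<open>B([x, y, \<xi>], z) = - B([x, y, z], \<xi>) = \<langle>ad\<^sup>*(x, y) \<xi>, z\<rangle>\<close>.  Likewise
  \<open>[\<xi>, \<eta>, x]\<close> lies in \<open>A\<close> and pairs with \<open>\<zeta>\<close> to \<open>- \<langle>x, [\<xi>, \<eta>, \<zeta>]\<rangle>\<close>, so \<open>(\<xi>, \<eta>) \<mapsto> [\<xi>, \<eta>, \<cdot>]\<close> is
  the coadjoint map of \<open>A\<^sup>*\<close> on \<open>A\<close>; in particular, in infinite dimension, that map exists because the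
  bracket of the triple provides it.  Expanding by trilinearity, the bracket is
  \<open>matched_bracket\<close>.  Since the Rota-Baxter operator of the triple preserves both summands, all
  representation axioms are the axioms of the big algebra evaluated on homogeneous elements
  (\<open>rota_baxter_representation_restrict\<close>, applied once to each summand).

  From a matched pair to a Manin triple: the two Rota-Baxter 3-Lie identities and the two
  compatibilities of the actions with the operators add up to the Rota-Baxter identity of the sum
  (\<open>matched_pair_rota_baxter_3_lie\<close>).  Invariance of the pairing holds because the actions are
  adjoint to the brackets, and because \<open>- w I - R\<^sup>*\<close> is the operator on \<open>A\<^sup>*\<close> that is dictated by
  \<open>B(R x, y) + B(x, R y) + w B(x, y) = 0\<close> (\<open>pseudo_metric_dual_pairing_form\<close>).
\<close>

section \<open>Elementary consequences of the axioms\<close>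

lemma linear_map_on_closed: "linear_map_on s V t W f \<Longrightarrow> x \<in> V \<Longrightarrow> f x \<in> W"
  by (simp add: linear_map_on_def)

lemma linear_map_on_add:
  "linear_map_on s V t W f \<Longrightarrow> x \<in> V \<Longrightarrow> y \<in> V \<Longrightarrow> f (x + y) = f x + f y"
  by (simp add: linear_map_on_def)

lemma linear_map_on_scale: "linear_map_on s V t W f \<Longrightarrow> x \<in> V \<Longrightarrow> f (s c x) = t c (f x)"
  by (simp add: linear_map_on_def)

lemma linear_map_on_0:
  assumes "linear_map_on s V t W f" and "0 \<in> V"
  shows "f 0 = 0"
  using linear_map_on_add[OF assms(1) assms(2) assms(2)] by simp

lemma alternating_imp_skew:
  fixes f :: "'v::ab_group_add \<Rightarrow> 'v \<Rightarrow> 'w::ab_group_add"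
  assumes "linear_map_on s V t W (\<lambda>u. f u x)" "linear_map_on s V t W (\<lambda>u. f u y)"
    and "linear_map_on s V t W (f (x + y))"
    and "x \<in> V" "y \<in> V" "f x x = 0" "f y y = 0" "f (x + y) (x + y) = 0"
  shows "f x y = - f y x"
proof -
  have "0 = f (x + y) x + f (x + y) y"
    using linear_map_on_add[OF assms(3-5)] assms(8) by simp
  also have "\<dots> = f x y + f y x"
    using linear_map_on_add[OF assms(1,4,5)] linear_map_on_add[OF assms(2,4,5)] assms(6,7)
    by simp
  finally show ?thesis by (simp add: eq_neg_iff_add_eq_0)
qed

context three_lie_algebra
begin

lemma zero_closed [simp]: "0 \<in> A"
  by (rule subspace_0[OF subspace_carrier])

lemma add_closed [simp]: "x \<in> A \<Longrightarrow> y \<in> A \<Longrightarrow> x + y \<in> A"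
  by (rule subspace_add[OF subspace_carrier])

lemma scale_closed [simp]: "x \<in> A \<Longrightarrow> s c x \<in> A"
  by (rule subspace_scale[OF subspace_carrier])

lemma bracket_closed [simp]: "x \<in> A \<Longrightarrow> y \<in> A \<Longrightarrow> z \<in> A \<Longrightarrow> br x y z \<in> A"
  using bracket_linear(3) by (rule linear_map_on_closed)

lemma bracket_zero:
  assumes "x \<in> A" "y \<in> A"
  shows "br 0 x y = 0" "br x 0 y = 0" "br x y 0 = 0"
  using linear_map_on_0[OF bracket_linear(1)[OF assms]]
    linear_map_on_0[OF bracket_linear(2)[OF assms]]
    linear_map_on_0[OF bracket_linear(3)[OF assms]] by simp_all

lemma bracket_add:
  assumes "x \<in> A" "y \<in> A" "u \<in> A" "v \<in> A"
  shows "br (u + v) x y = br u x y + br v x y"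
    and "br x (u + v) y = br x u y + br x v y"
    and "br x y (u + v) = br x y u + br x y v"
  using linear_map_on_add[OF bracket_linear(1)[OF assms(1,2)] assms(3,4)]
    linear_map_on_add[OF bracket_linear(2)[OF assms(1,2)] assms(3,4)]
    linear_map_on_add[OF bracket_linear(3)[OF assms(1,2)] assms(3,4)] by simp_all

lemma bracket_swap12: "x \<in> A \<Longrightarrow> y \<in> A \<Longrightarrow> z \<in> A \<Longrightarrow> br x y z = - br y x z"
  by (rule alternating_imp_skew[where f = "\<lambda>u v. br u v z"])
    (auto intro: bracket_linear bracket_alternating)

lemma bracket_swap23: "x \<in> A \<Longrightarrow> y \<in> A \<Longrightarrow> z \<in> A \<Longrightarrow> br x y z = - br x z y"
  by (rule alternating_imp_skew[where f = "\<lambda>u v. br x u v"])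
    (auto intro: bracket_linear bracket_alternating)

lemma bracket_cycle:
  assumes "x \<in> A" "y \<in> A" "z \<in> A"
  shows "br x y z = br y z x"
  using bracket_swap12[OF assms] bracket_swap23[OF assms(2,1,3)] by simp

text \<open>
  This is the matched bracket in disguise: if \<open>x, y, z\<close> lie in one subalgebra and \<open>a, b, c\<close> in a
  complementary one, with mixed brackets going to the summand of the odd argument out, the two
  parenthesised groups are the two components.
\<close>
lemma bracket_expand:
  assumes "x \<in> A" "y \<in> A" "z \<in> A" "a \<in> A" "b \<in> A" "c \<in> A"
  shows "br (x + a) (y + b) (z + c)
    = (br x y z + br a b z + br b c x + br c a y) + (br a b c + br x y c + br y z a + br z x b)"
proof -
  have "br (x + a) (y + b) (z + c) = br x y z + br x y c + br x b z + br x b c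
      + br a y z + br a y c + br a b z + br a b c"
    using assms by (simp add: bracket_add ac_simps)
  moreover have "br x b z = br z x b" "br x b c = br b c x" "br a y z = br y z a" "br a y c = br c a y"
    using assms bracket_cycle by metis+
  ultimately show ?thesis by (simp add: ac_simps)
qed

end

lemma three_lie_algebra_cong:
  assumes "three_lie_algebra s A br"
    and eq: "\<And>x y z. x \<in> A \<Longrightarrow> y \<in> A \<Longrightarrow> z \<in> A \<Longrightarrow> br' x y z = br x y z"
  shows "three_lie_algebra s A br'"
proof -
  interpret three_lie_algebra s A br by (rule assms(1))
  show ?thesis
  proof unfold_locales
    fix x y assume xy: "x \<in> A" "y \<in> A"
    show "linear_map_on s A s A (\<lambda>z. br' z x y)" "linear_map_on s A s A (\<lambda>z. br' x z y)"
      "linear_map_on s A s A (\<lambda>z. br' x y z)"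
      using bracket_linear[OF xy] xy unfolding linear_map_on_def by (simp_all add: eq)
    show "br' x x y = 0" "br' x y x = 0" "br' y x x = 0"
      using bracket_alternating[OF xy] xy by (simp_all add: eq)
  next
    fix x1 x2 y1 y2 y3
    assume X: "x1 \<in> A" "x2 \<in> A" "y1 \<in> A" "y2 \<in> A" "y3 \<in> A"
    show "br' x1 x2 (br' y1 y2 y3)
        = br' (br' x1 x2 y1) y2 y3 + br' y1 (br' x1 x2 y2) y3 + br' y1 y2 (br' x1 x2 y3)"
      using fundamental_identity[OF X] X by (simp add: eq)
  qed (rule subspace_carrier)
qed

context rota_baxter_3_lie
begin

lemma R_closed [simp]: "x \<in> A \<Longrightarrow> R x \<in> A"
  using R_linear by (rule linear_map_on_closed)

lemma R_zero: "R 0 = 0"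
  using R_linear zero_closed by (rule linear_map_on_0)

end

context three_lie_representation
begin

lemma action_closed [simp]: "x \<in> A \<Longrightarrow> y \<in> A \<Longrightarrow> v \<in> V \<Longrightarrow> \<rho> x y v \<in> V"
  using action_linear by (rule linear_map_on_closed)

lemma action_zero:
  "x \<in> A \<Longrightarrow> y \<in> A \<Longrightarrow> \<rho> x y 0 = 0"
  "y \<in> A \<Longrightarrow> v \<in> V \<Longrightarrow> \<rho> 0 y v = 0"
  "x \<in> A \<Longrightarrow> v \<in> V \<Longrightarrow> \<rho> x 0 v = 0"
  using linear_map_on_0[OF action_linear] linear_map_on_0[OF action_bilinear(1)]
    linear_map_on_0[OF action_bilinear(2)] V.subspace_0[OF subspace_V] by simp_all

end

section \<open>Transport and restriction along linear maps\<close>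

text \<open>
  The summands of a direct sum carry brackets copied from their own types; this lemma shows that
  such copies are Rota-Baxter 3-Lie algebras again.
\<close>
lemma rota_baxter_3_lie_image:
  assumes "rota_baxter_3_lie s A br w R" and "vector_space t"
    and i: "linear_map_on s A t UNIV i"
    and br2: "\<And>x y z. x \<in> A \<Longrightarrow> y \<in> A \<Longrightarrow> z \<in> A \<Longrightarrow> br2 (i x) (i y) (i z) = i (br x y z)"
    and R2: "\<And>x. x \<in> A \<Longrightarrow> R2 (i x) = i (R x)"
  shows "rota_baxter_3_lie t (i ` A) br2 w R2"
proof -
  interpret rota_baxter_3_lie s A br w R by (rule assms(1))
  interpret T: vector_space t by (rule assms(2))
  note i_simps = linear_map_on_add[OF i, symmetric] linear_map_on_scale[OF i, symmetric]
  have i0: "i 0 = 0" using linear_map_on_0[OF i] by simp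
  have sub: "T.subspace (i ` A)"
    unfolding T.subspace_def using i0 by (auto simp: i_simps image_iff intro: zero_closed)
  have lin: "linear_map_on t (i ` A) t (i ` A) g"
    if f: "linear_map_on s A s A f" and g: "\<And>x. x \<in> A \<Longrightarrow> g (i x) = i (f x)" for f g
    unfolding linear_map_on_def
    by (auto simp: i_simps g linear_map_on_closed[OF f] linear_map_on_add[OF f] linear_map_on_scale[OF f])
  show ?thesis
  proof unfold_locales
    fix p q assume "p \<in> i ` A" "q \<in> i ` A"
    then obtain x y where xy: "x \<in> A" "y \<in> A" "p = i x" "q = i y" by auto
    show "linear_map_on t (i ` A) t (i ` A) (\<lambda>z. br2 z p q)"
      by (rule lin[OF bracket_linear(1)[OF xy(1,2)]]) (simp add: xy br2)
    show "linear_map_on t (i ` A) t (i ` A) (\<lambda>z. br2 p z q)"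
      by (rule lin[OF bracket_linear(2)[OF xy(1,2)]]) (simp add: xy br2)
    show "linear_map_on t (i ` A) t (i ` A) (\<lambda>z. br2 p q z)"
      by (rule lin[OF bracket_linear(3)[OF xy(1,2)]]) (simp add: xy br2)
    show "br2 p p q = 0" "br2 p q p = 0" "br2 q p p = 0"
      by (simp_all add: xy br2 bracket_alternating i0)
  next
    fix x1 x2 y1 y2 y3
    assume "x1 \<in> i ` A" "x2 \<in> i ` A" "y1 \<in> i ` A" "y2 \<in> i ` A" "y3 \<in> i ` A"
    then obtain a1 a2 b1 b2 b3 where A: "a1 \<in> A" "a2 \<in> A" "b1 \<in> A" "b2 \<in> A" "b3 \<in> A"
      and eq: "x1 = i a1" "x2 = i a2" "y1 = i b1" "y2 = i b2" "y3 = i b3" by auto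
    show "br2 x1 x2 (br2 y1 y2 y3)
        = br2 (br2 x1 x2 y1) y2 y3 + br2 y1 (br2 x1 x2 y2) y3 + br2 y1 y2 (br2 x1 x2 y3)"
      using fundamental_identity[OF A] A by (simp add: eq br2 i_simps)
  next
    show "linear_map_on t (i ` A) t (i ` A) R2"
      by (rule lin[OF R_linear R2])
  next
    fix x y z
    assume "x \<in> i ` A" "y \<in> i ` A" "z \<in> i ` A"
    then show "br2 (R2 x) (R2 y) (R2 z)
        = R2 (br2 (R2 x) (R2 y) z + br2 (R2 x) y (R2 z) + br2 x (R2 y) (R2 z)
             + t w (br2 (R2 x) y z + br2 x (R2 y) z + br2 x y (R2 z))
             + t (w\<^sup>2) (br2 x y z))"
      by (auto simp: br2 R2 i_simps rota_baxter)
  qed (rule sub)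
qed

text \<open>
  A Rota-Baxter 3-Lie algebra that contains \<open>A\<close> as a subalgebra, and a subspace \<open>V\<close> stable under the
  operator and under \<open>[x, y, \<cdot>]\<close> for \<open>x, y \<in> A\<close>, makes \<open>V\<close> a representation of \<open>A\<close>: each axiom is an
  axiom of the large algebra with one argument taken from \<open>V\<close>.  The embeddings \<open>i\<close> and \<open>j\<close> are
  arbitrary, so that either summand of a direct sum can play the role of \<open>A\<close>.
\<close>
lemma rota_baxter_representation_restrict:
  assumes "rota_baxter_3_lie sA A br w R" and "rota_baxter_3_lie t M brD w RD"
    and "vector_space sV" and "module.subspace sV V"
    and i: "linear_map_on sA A t M i" and j: "linear_map_on sV V t M j" and "inj_on j V"
    and bracket: "\<And>x y z. x \<in> A \<Longrightarrow> y \<in> A \<Longrightarrow> z \<in> A \<Longrightarrow> brD (i x) (i y) (i z) = i (br x y z)"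
    and closed: "\<And>x y v. x \<in> A \<Longrightarrow> y \<in> A \<Longrightarrow> v \<in> V \<Longrightarrow> \<rho> x y v \<in> V"
    and action: "\<And>x y v. x \<in> A \<Longrightarrow> y \<in> A \<Longrightarrow> v \<in> V \<Longrightarrow> brD (i x) (i y) (j v) = j (\<rho> x y v)"
    and R_i: "\<And>x. x \<in> A \<Longrightarrow> RD (i x) = i (R x)"
    and RV_closed: "\<And>v. v \<in> V \<Longrightarrow> RV v \<in> V"
    and R_j: "\<And>v. v \<in> V \<Longrightarrow> RD (j v) = j (RV v)"
  shows "rota_baxter_representation sA A br w R sV V \<rho> RV"
proof -
  interpret A: rota_baxter_3_lie sA A br w R by (rule assms(1))
  interpret D: rota_baxter_3_lie t M brD w RD by (rule assms(2))
  interpret V: vector_space sV by (rule assms(3))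
  note V_simps [simp] = V.subspace_0[OF assms(4)] V.subspace_add[OF assms(4)]
    V.subspace_scale[OF assms(4)] closed RV_closed
  note i_in [simp] = linear_map_on_closed[OF i] and j_in [simp] = linear_map_on_closed[OF j]
  note i_simps = linear_map_on_add[OF i] linear_map_on_scale[OF i]
  note j_simps = linear_map_on_add[OF j] linear_map_on_scale[OF j]
  note D_scale = linear_map_on_scale[OF D.bracket_linear(1)]
    linear_map_on_scale[OF D.bracket_linear(2)] linear_map_on_scale[OF D.bracket_linear(3)]
  note RD_simps = linear_map_on_add[OF D.R_linear] linear_map_on_scale[OF D.R_linear]
  have cancel: "u = v" if "j u = j v" "u \<in> V" "v \<in> V" for u v
    using that \<open>inj_on j V\<close> by (rule_tac inj_onD)
  have lin_v: "linear_map_on sV V sV V (\<rho> x y)" if "x \<in> A" "y \<in> A" for x y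
    unfolding linear_map_on_def
  proof (intro conjI ballI allI)
    fix u u' c assume u: "u \<in> V" "u' \<in> V"
    show "\<rho> x y u \<in> V" using that u by simp
    show "\<rho> x y (u + u') = \<rho> x y u + \<rho> x y u'"
      by (rule cancel) (use that u in \<open>simp_all add: j_simps i_simps action[symmetric] D.bracket_add\<close>)
    show "\<rho> x y (sV c u) = sV c (\<rho> x y u)"
      by (rule cancel) (use that u in \<open>simp_all add: j_simps i_simps action[symmetric] D_scale\<close>)
  qed
  have lin1: "linear_map_on sA A sV V (\<lambda>x. \<rho> x y v)" if "y \<in> A" "v \<in> V" for y v
    unfolding linear_map_on_def
  proof (intro conjI ballI allI)
    fix u u' c assume u: "u \<in> A" "u' \<in> A"
    show "\<rho> u y v \<in> V" using that u by simp
    show "\<rho> (u + u') y v = \<rho> u y v + \<rho> u' y v"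
      by (rule cancel) (use that u in \<open>simp_all add: j_simps i_simps action[symmetric] D.bracket_add\<close>)
    show "\<rho> (sA c u) y v = sV c (\<rho> u y v)"
      by (rule cancel) (use that u in \<open>simp_all add: j_simps i_simps action[symmetric] D_scale\<close>)
  qed
  have lin2: "linear_map_on sA A sV V (\<lambda>y. \<rho> x y v)" if "x \<in> A" "v \<in> V" for x v
    unfolding linear_map_on_def
  proof (intro conjI ballI allI)
    fix u u' c assume u: "u \<in> A" "u' \<in> A"
    show "\<rho> x u v \<in> V" using that u by simp
    show "\<rho> x (u + u') v = \<rho> x u v + \<rho> x u' v"
      by (rule cancel) (use that u in \<open>simp_all add: j_simps i_simps action[symmetric] D.bracket_add\<close>)
    show "\<rho> x (sA c u) v = sV c (\<rho> x u v)"
      by (rule cancel) (use that u in \<open>simp_all add: j_simps i_simps action[symmetric] D_scale\<close>)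
  qed
  have lin_RV: "linear_map_on sV V sV V RV"
    unfolding linear_map_on_def
    by (auto intro!: cancel simp: j_simps R_j[symmetric] RD_simps)
  have j0: "j 0 = 0" using linear_map_on_0[OF j] by simp
  have alt: "\<rho> x x v = 0" if "x \<in> A" "v \<in> V" for x v
    using that by (auto intro!: cancel simp: j0 action[symmetric] D.bracket_alternating)
  have skew: "\<rho> x y v = - \<rho> y x v" if "x \<in> A" "y \<in> A" "v \<in> V" for x y v
    by (rule alternating_imp_skew[where f = "\<lambda>x y. \<rho> x y v"])
      (use that in \<open>auto intro: lin1 lin2 alt\<close>)
  have action': "brD (j v) (i x) (i y) = j (\<rho> x y v)" "brD (i x) (j v) (i y) = j (\<rho> y x v)"
    if "x \<in> A" "y \<in> A" "v \<in> V" for x y v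
    using that D.bracket_cycle[of "j v" "i x" "i y"] D.bracket_cycle[of "i y" "i x" "j v"]
      D.bracket_cycle[of "i x" "j v" "i y"] D.bracket_cycle[of "j v" "i y" "i x"] by (simp_all add: action)
  have neg: "\<rho> x y (- v) = - \<rho> x y v" if "x \<in> A" "y \<in> A" "v \<in> V" for x y v
    using linear_map_on_scale[OF lin_v[OF that(1,2)] that(3), of "-1"] by simp
  show ?thesis
  proof unfold_locales
    fix x1 x2 x3 x4 v
    assume X: "x1 \<in> A" "x2 \<in> A" "x3 \<in> A" "x4 \<in> A" "v \<in> V"
    \<comment> \<open>The commutator axiom is the fundamental identity with \<open>v\<close> as the last inner argument.\<close>
    have "j (\<rho> x1 x2 (\<rho> x3 x4 v))
        = j (\<rho> (br x1 x2 x3) x4 v + \<rho> x3 (br x1 x2 x4) v + \<rho> x3 x4 (\<rho> x1 x2 v))"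
      using D.fundamental_identity[of "i x1" "i x2" "i x3" "i x4" "j v"] X
      by (simp add: action bracket j_simps)
    then have "\<rho> x1 x2 (\<rho> x3 x4 v)
        = \<rho> (br x1 x2 x3) x4 v + \<rho> x3 (br x1 x2 x4) v + \<rho> x3 x4 (\<rho> x1 x2 v)"
      using X by (rule_tac cancel) simp_all
    then show "\<rho> x1 x2 (\<rho> x3 x4 v) - \<rho> x3 x4 (\<rho> x1 x2 v)
        = \<rho> (br x1 x2 x3) x4 v - \<rho> (br x1 x2 x4) x3 v"
      using X skew[of x3 "br x1 x2 x4" v] by simp
    \<comment> \<open>The other axiom is the derivation property of \<open>[v, x4, \<cdot>]\<close>, that is, \<open>v\<close> outside.\<close>
    have "j (\<rho> x4 (br x1 x2 x3) v)
        = j (\<rho> x2 x3 (\<rho> x4 x1 v) + \<rho> x3 x1 (\<rho> x4 x2 v) + \<rho> x1 x2 (\<rho> x4 x3 v))"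
      using D.fundamental_identity[of "j v" "i x4" "i x1" "i x2" "i x3"] X
      by (simp add: action action' bracket j_simps)
    then have "\<rho> x4 (br x1 x2 x3) v
        = \<rho> x2 x3 (\<rho> x4 x1 v) + \<rho> x3 x1 (\<rho> x4 x2 v) + \<rho> x1 x2 (\<rho> x4 x3 v)"
      using X by (rule_tac cancel) simp_all
    moreover have "\<rho> (br x1 x2 x3) x4 v = - \<rho> x4 (br x1 x2 x3) v"
      using X by (intro skew) simp_all
    moreover have "\<rho> x2 x3 (\<rho> x4 x1 v) = - \<rho> x2 x3 (\<rho> x1 x4 v)"
      "\<rho> x3 x1 (\<rho> x4 x2 v) = - \<rho> x3 x1 (\<rho> x2 x4 v)"
      "\<rho> x1 x2 (\<rho> x4 x3 v) = - \<rho> x1 x2 (\<rho> x3 x4 v)"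
      using X skew[of x4 x1 v] skew[of x4 x2 v] skew[of x4 x3 v] by (simp_all only: neg closed)
    ultimately show "\<rho> (br x1 x2 x3) x4 v
        = \<rho> x1 x2 (\<rho> x3 x4 v) + \<rho> x2 x3 (\<rho> x1 x4 v) + \<rho> x3 x1 (\<rho> x2 x4 v)"
      by simp
  next
    show "linear_map_on sV V sV V RV" by (rule lin_RV)
  next
    fix x1 x2 v
    assume X: "x1 \<in> A" "x2 \<in> A" "v \<in> V"
    let ?T = "\<rho> (R x1) (R x2) v + \<rho> (R x1) x2 (RV v) + \<rho> x1 (R x2) (RV v)
      + sV w (\<rho> (R x1) x2 v + \<rho> x1 (R x2) v + \<rho> x1 x2 (RV v)) + sV (w\<^sup>2) (\<rho> x1 x2 v)"
    have "j (\<rho> (R x1) (R x2) (RV v)) = j (RV ?T)"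
      using D.rota_baxter[of "i x1" "i x2" "j v"] X
      by (simp add: action R_i R_j j_simps[symmetric])
    then have "\<rho> (R x1) (R x2) (RV v) = RV ?T"
      using X by (rule_tac cancel) simp_all
    then show "\<rho> (R x1) (R x2) (RV v)
        = RV (\<rho> (R x1) (R x2) v)
          + RV (\<rho> (R x1) x2 (RV v) + \<rho> x1 (R x2) (RV v) + sV w (\<rho> x1 x2 (RV v)))
          + sV w (RV (\<rho> (R x1) x2 v + \<rho> x1 (R x2) v + sV w (\<rho> x1 x2 v)))"
      using X by (simp add: linear_map_on_add[OF lin_RV] linear_map_on_scale[OF lin_RV]
          V.scale_right_distrib power2_eq_square ac_simps)
  qed (fact assms(4) lin_v lin1 lin2 alt)+
qed


section \<open>The Rota-Baxter operator of a matched pair\<close>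

text \<open>
  One component of \<open>matched_bracket\<close>.  Both components have this shape, with the roles of the two
  algebras exchanged, so that the Rota-Baxter identity needs to be verified for one of them only.
\<close>
definition extended_bracket ::
  "('v::ab_group_add \<Rightarrow> 'v \<Rightarrow> 'v \<Rightarrow> 'v) \<Rightarrow> ('a \<Rightarrow> 'a \<Rightarrow> 'v \<Rightarrow> 'v) \<Rightarrow>
   'v \<Rightarrow> 'a \<Rightarrow> 'v \<Rightarrow> 'a \<Rightarrow> 'v \<Rightarrow> 'a \<Rightarrow> 'v"
  where "extended_bracket brV \<rho> x a y b z c = brV x y z + \<rho> a b z + \<rho> b c x + \<rho> c a y"

lemma matched_bracket_eq:
  "matched_bracket brA brB \<rho> \<phi> (x, a) (y, b) (z, c)
    = (extended_bracket brA \<phi> x a y b z c, extended_bracket brB \<rho> a x b y c z)"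
  by (simp add: matched_bracket_def extended_bracket_def)

text \<open>
  The compatibility of \<open>\<rho>\<close> with the operators is the Rota-Baxter identity on two arguments from \<open>A\<close>
  and one from \<open>V\<close>: once its right-hand side is collected under \<open>R\<^sub>V\<close>, it has the same form as the
  identity for \<open>brV\<close>, and the four summands of the extended bracket can be treated alike.
\<close>
lemma (in rota_baxter_representation) extended_bracket_rota_baxter:
  assumes "rota_baxter_3_lie sV V brV w R\<^sub>V"
    and V: "x \<in> V" "y \<in> V" "z \<in> V" and A: "a \<in> A" "b \<in> A" "c \<in> A"
  shows "extended_bracket brV \<rho> (R\<^sub>V x) (R a) (R\<^sub>V y) (R b) (R\<^sub>V z) (R c)
    = R\<^sub>V (extended_bracket brV \<rho> (R\<^sub>V x) (R a) (R\<^sub>V y) (R b) z c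
        + extended_bracket brV \<rho> (R\<^sub>V x) (R a) y b (R\<^sub>V z) (R c)
        + extended_bracket brV \<rho> x a (R\<^sub>V y) (R b) (R\<^sub>V z) (R c)
        + sV w (extended_bracket brV \<rho> (R\<^sub>V x) (R a) y b z c
          + extended_bracket brV \<rho> x a (R\<^sub>V y) (R b) z c
          + extended_bracket brV \<rho> x a y b (R\<^sub>V z) (R c))
        + sV (w\<^sup>2) (extended_bracket brV \<rho> x a y b z c))"
proof -
  interpret V: rota_baxter_3_lie sV V brV w R\<^sub>V by (rule assms(1))
  note RV_add = linear_map_on_add[OF R\<^sub>V_linear] and RV_scale = linear_map_on_scale[OF R\<^sub>V_linear]
  define T where "T a b v = \<rho> (R a) (R b) v + \<rho> (R a) b (R\<^sub>V v) + \<rho> a (R b) (R\<^sub>V v)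
    + sV w (\<rho> (R a) b v + \<rho> a (R b) v + \<rho> a b (R\<^sub>V v)) + sV (w\<^sup>2) (\<rho> a b v)" for a b v
  define T\<^sub>0 where "T\<^sub>0 = brV (R\<^sub>V x) (R\<^sub>V y) z + brV (R\<^sub>V x) y (R\<^sub>V z) + brV x (R\<^sub>V y) (R\<^sub>V z)
    + sV w (brV (R\<^sub>V x) y z + brV x (R\<^sub>V y) z + brV x y (R\<^sub>V z)) + sV (w\<^sup>2) (brV x y z)"
  have T: "\<rho> (R a) (R b) (R\<^sub>V v) = R\<^sub>V (T a b v)" if "a \<in> A" "b \<in> A" "v \<in> V" for a b v
    unfolding T_def rota_baxter_action[OF that] using that
    by (simp add: RV_add RV_scale V.scale_right_distrib power2_eq_square ac_simps)
  have T_closed: "T a b v \<in> V" if "a \<in> A" "b \<in> A" "v \<in> V" for a b v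
    using that by (simp add: T_def)
  have T\<^sub>0: "brV (R\<^sub>V x) (R\<^sub>V y) (R\<^sub>V z) = R\<^sub>V T\<^sub>0"
    unfolding T\<^sub>0_def by (rule V.rota_baxter[OF V])
  have T\<^sub>0_closed: "T\<^sub>0 \<in> V"
    using V by (simp add: T\<^sub>0_def)
  have "extended_bracket brV \<rho> (R\<^sub>V x) (R a) (R\<^sub>V y) (R b) (R\<^sub>V z) (R c)
      = R\<^sub>V (T\<^sub>0 + T a b z + T b c x + T c a y)"
    using V A by (simp add: extended_bracket_def T\<^sub>0 T RV_add T_closed T\<^sub>0_closed)
  then show ?thesis
    by (simp add: T\<^sub>0_def T_def extended_bracket_def V.scale_right_distrib ac_simps)
qed

lemma linear_map_on_map_prod:
  assumes "vector_space_pair s t"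
    and "linear_map_on s A s A f" "linear_map_on t B t B g"
  shows "linear_map_on (module_prod.scale s t) (A \<times> B) (module_prod.scale s t) (A \<times> B) (map_prod f g)"
proof -
  interpret vector_space_pair s t by (rule assms(1))
  interpret P: vector_space_prod s t by unfold_locales
  show ?thesis
    using assms(2,3) unfolding linear_map_on_def by (auto simp: P.scale_prod)
qed

lemma (in matched_pair_rota_baxter) matched_pair_rota_baxter_3_lie:
  "rota_baxter_3_lie (module_prod.scale sA sB) (A \<times> B) (matched_bracket brA brB \<rho> \<phi>) w
    (map_prod R\<^sub>A R\<^sub>B)"
proof -
  interpret D: three_lie_algebra "module_prod.scale sA sB" "A \<times> B" "matched_bracket brA brB \<rho> \<phi>"
    by (rule matched_three_lie)
  interpret P: vector_space_prod sA sB by unfold_locales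
  show ?thesis
  proof unfold_locales
    show "linear_map_on P.scale (A \<times> B) P.scale (A \<times> B) (map_prod R\<^sub>A R\<^sub>B)"
      by (rule linear_map_on_map_prod[OF P.vector_space_pair_axioms repA.R_linear repB.R_linear])
  next
    fix p q r assume "p \<in> A \<times> B" "q \<in> A \<times> B" "r \<in> A \<times> B"
    then obtain x a y b z c where eq: "p = (x, a)" "q = (y, b)" "r = (z, c)"
      and A: "x \<in> A" "y \<in> A" "z \<in> A" and B: "a \<in> B" "b \<in> B" "c \<in> B" by auto
    let ?m = "matched_bracket brA brB \<rho> \<phi>" and ?R = "map_prod R\<^sub>A R\<^sub>B"
    show "?m (?R p) (?R q) (?R r)
        = ?R (?m (?R p) (?R q) r + ?m (?R p) q (?R r) + ?m p (?R q) (?R r)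
             + P.scale w (?m (?R p) q r + ?m p (?R q) r + ?m p q (?R r))
             + P.scale (w\<^sup>2) (?m p q r))"
      using repB.extended_bracket_rota_baxter[OF repA.rota_baxter_3_lie_axioms A B]
        repA.extended_bracket_rota_baxter[OF repB.rota_baxter_3_lie_axioms B A]
      by (simp add: eq matched_bracket_eq P.scale_prod)
  qed
qed

section \<open>The pairing form and the projections\<close>

text \<open>
  Moving the fourth argument of \<open>B([p, q, r], t)\<close> into the brackets by means of the two coadjoint
  maps turns this scalar into a sum of terms \<open>\<xi>([x, y, z])\<close> and \<open>[\<xi>, \<eta>, \<zeta>](x)\<close>; exchanging \<open>r\<close> and
  \<open>t\<close> changes the sign of each by skew-symmetry of the two brackets.  Nondegeneracy holds in every
  dimension because linear forms separate points.
\<close>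
lemma pseudo_metric_dual_pairing_form:
  fixes s :: "'k::field \<Rightarrow> 'a::ab_group_add \<Rightarrow> 'a"
  assumes "vector_space s" and "three_lie_algebra s UNIV br"
    and "three_lie_algebra fun_scale (dual_space s) br'"
    and \<phi>: "coadjoint_on_predual s br' \<phi>"
  shows "pseudo_metric_form (module_prod.scale s fun_scale) (UNIV \<times> dual_space s)
    (matched_bracket br br' (coadjoint br) \<phi>) w (map_prod R (dual_operator w R)) dual_pairing_form"
proof -
  interpret A: three_lie_algebra s UNIV br by (rule assms(2))
  interpret D: three_lie_algebra fun_scale "dual_space s" br' by (rule assms(3))
  interpret P: vector_space_prod s "fun_scale :: 'k \<Rightarrow> ('a \<Rightarrow> 'k) \<Rightarrow> 'a \<Rightarrow> 'k" by unfold_locales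
  have add: "\<xi> (x + y) = \<xi> x + \<xi> y" and scale: "\<xi> (s c x) = c * \<xi> x" if "\<xi> \<in> dual_space s" for \<xi> x y c
  proof -
    interpret Vector_Spaces.linear s "(*)" \<xi> using that by (simp add: dual_space_def)
    show "\<xi> (x + y) = \<xi> x + \<xi> y" "\<xi> (s c x) = c * \<xi> x" by (rule add, rule scale)
  qed
  have neg: "\<xi> (- x) = - \<xi> x" if "\<xi> \<in> dual_space s" for \<xi> x
    using scale[OF that, of "-1" x] by simp
  have \<phi>: "\<zeta> (\<phi> \<xi> \<eta> x) = - br' \<xi> \<eta> \<zeta> x"
    if "\<xi> \<in> dual_space s" "\<eta> \<in> dual_space s" "\<zeta> \<in> dual_space s" for \<xi> \<eta> \<zeta> x
    using assms(4) that unfolding coadjoint_on_predual_def by blast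
  show ?thesis
    unfolding pseudo_metric_form_def
  proof (intro conjI ballI impI)
    fix p :: "'a \<times> ('a \<Rightarrow> 'k)" assume p: "p \<in> UNIV \<times> dual_space s"
    then show "linear_map_on P.scale (UNIV \<times> dual_space s) (*) UNIV (\<lambda>q. dual_pairing_form q p)"
      by (auto simp: linear_map_on_def dual_pairing_form_def P.scale_prod add scale fun_scale_def
          algebra_simps)
    show "linear_map_on P.scale (UNIV \<times> dual_space s) (*) UNIV (dual_pairing_form p)"
      using p by (auto simp: linear_map_on_def dual_pairing_form_def P.scale_prod add scale fun_scale_def
          algebra_simps)
    assume orth: "\<forall>q\<in>UNIV \<times> dual_space s. dual_pairing_form p q = 0"
    obtain x \<xi> where eq: "p = (x, \<xi>)" and \<xi>: "\<xi> \<in> dual_space s" using p by auto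
    have "\<xi> y = 0" for y
      using bspec[OF orth, of "(y, 0)"] by (simp add: eq dual_pairing_form_def)
    moreover have "x = 0"
    proof (rule dual_separates[OF assms(1)])
      fix \<zeta> assume \<zeta>: "\<zeta> \<in> dual_space s"
      then show "\<zeta> x = \<zeta> 0"
        using bspec[OF orth, of "(0, \<zeta>)"] scale[OF \<zeta>, of 0 0] scale[OF \<xi>, of 0 0]
        by (simp add: eq dual_pairing_form_def)
    qed
    ultimately show "p = 0" by (auto simp: eq zero_prod_def)
  next
    fix p q :: "'a \<times> ('a \<Rightarrow> 'k)"
    show "dual_pairing_form p q = dual_pairing_form q p"
      by (cases p; cases q) (simp add: dual_pairing_form_def)
  next
    fix p q r t :: "'a \<times> ('a \<Rightarrow> 'k)" assume "p \<in> UNIV \<times> dual_space s" "q \<in> UNIV \<times> dual_space s"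
      "r \<in> UNIV \<times> dual_space s" "t \<in> UNIV \<times> dual_space s"
    then obtain x1 x2 x3 x4 a1 a2 a3 a4
      where eq: "p = (x1, a1)" "q = (x2, a2)" "r = (x3, a3)" "t = (x4, a4)"
        and a: "a1 \<in> dual_space s" "a2 \<in> dual_space s" "a3 \<in> dual_space s" "a4 \<in> dual_space s"
      by auto
    have skew: "br x2 x4 x3 = - br x2 x3 x4" "br x4 x1 x3 = - br x3 x1 x4"
      using A.bracket_swap23[of x2 x4 x3] A.bracket_cycle[of x4 x1 x3] A.bracket_swap12[of x1 x3 x4]
      by simp_all
    have skew': "br' a2 a4 a3 = - br' a2 a3 a4" "br' a4 a1 a3 = - br' a3 a1 a4"
      using D.bracket_swap23[of a2 a4 a3] D.bracket_cycle[of a4 a1 a3] D.bracket_swap12[of a1 a3 a4] a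
      by auto
    show "dual_pairing_form (matched_bracket br br' (coadjoint br) \<phi> p q r) t
        + dual_pairing_form (matched_bracket br br' (coadjoint br) \<phi> p q t) r = 0"
      using a by (simp add: eq matched_bracket_def dual_pairing_form_def coadjoint_def add neg \<phi> skew skew')
  next
    fix p q :: "'a \<times> ('a \<Rightarrow> 'k)" assume "p \<in> UNIV \<times> dual_space s" "q \<in> UNIV \<times> dual_space s"
    then show "dual_pairing_form (map_prod R (dual_operator w R) p) q
        + dual_pairing_form p (map_prod R (dual_operator w R) q) + w * dual_pairing_form p q = 0"
      by (cases p; cases q) (simp add: dual_pairing_form_def dual_operator_def fun_scale_def
          transpose_map_def algebra_simps)
  qed
qed

lemma proj_along_fst:
  "proj_along (UNIV \<times> {0}) ({0} \<times> S) (u, v) = (u, 0)" if "v \<in> S" for u :: "'a::ab_group_add" and v :: "'b::ab_group_add"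
  unfolding proj_along_def using that by (intro the_equality) auto

lemma proj_along_snd:
  "proj_along ({0} \<times> S) (UNIV \<times> {0}) (u, v) = (0, v)" if "v \<in> S" for u :: "'a::ab_group_add" and v :: "'b::ab_group_add"
  unfolding proj_along_def using that by (intro the_equality) auto


lemma linear_map_on_pair_embedding:
  assumes "vector_space_pair s t" and "module.subspace s A" and "module.subspace t B"
  shows "linear_map_on s A (module_prod.scale s t) (A \<times> B) (\<lambda>x. (x, 0))"
    and "linear_map_on t B (module_prod.scale s t) (A \<times> B) (\<lambda>a. (0, a))"
proof -
  interpret vector_space_pair s t by (rule assms(1))
  interpret P: vector_space_prod s t by unfold_locales
  show "linear_map_on s A P.scale (A \<times> B) (\<lambda>x. (x, 0))"
    "linear_map_on t B P.scale (A \<times> B) (\<lambda>a. (0, a))"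
    using vs1.subspace_0[OF assms(2)] vs2.subspace_0[OF assms(3)]
    by (simp_all add: linear_map_on_def P.scale_prod)
qed

section \<open>Manin triples and matched pairs\<close>

lemma manin_triple_of_matched_pair:
  fixes s :: "'k::field \<Rightarrow> 'a::ab_group_add \<Rightarrow> 'a"
  assumes \<phi>: "coadjoint_on_predual s br' \<phi>"
    and "matched_pair_rota_baxter s UNIV br fun_scale (dual_space s) br'
      w R (dual_operator w R) (coadjoint br) \<phi>"
  shows "manin_triple (module_prod.scale s fun_scale) w
    (UNIV \<times> dual_space s) (matched_bracket br br' (coadjoint br) \<phi>)
    (map_prod R (dual_operator w R)) dual_pairing_form
    (UNIV \<times> {0}) (left_bracket br) (left_operator R)
    ({0} \<times> dual_space s) (right_bracket br') (right_operator (dual_operator w R))"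
proof -
  interpret matched_pair_rota_baxter s UNIV br fun_scale "dual_space s" br'
    w R "dual_operator w R" "coadjoint br" \<phi> by (rule assms(2))
  interpret P: vector_space_prod s "fun_scale :: 'k \<Rightarrow> ('a \<Rightarrow> 'k) \<Rightarrow> 'a \<Rightarrow> 'k" by unfold_locales
  have ranges: "UNIV \<times> {0} = (\<lambda>x. (x, 0)) ` UNIV" "{0} \<times> dual_space s = (\<lambda>a. (0, a)) ` dual_space s"
    by auto
  note emb = linear_map_on_pair_embedding[OF P.vector_space_pair_axioms
      repA.subspace_carrier repB.subspace_carrier]
  have emb': "linear_map_on s UNIV P.scale UNIV (\<lambda>x. (x, 0))"
    "linear_map_on fun_scale (dual_space s) P.scale UNIV (\<lambda>a. (0, a))"
    using emb by (simp_all add: linear_map_on_def)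
  note zeros = repA.bracket_zero repB.bracket_zero repA.action_zero repB.action_zero
    repA.R_zero repB.R_zero
  show ?thesis
    unfolding manin_triple_def
  proof (intro conjI ballI)
    show "rota_baxter_3_lie P.scale (UNIV \<times> dual_space s)
        (matched_bracket br br' (coadjoint br) \<phi>) w (map_prod R (dual_operator w R))"
      by (rule matched_pair_rota_baxter_3_lie)
    show "pseudo_metric_form P.scale (UNIV \<times> dual_space s)
        (matched_bracket br br' (coadjoint br) \<phi>) w (map_prod R (dual_operator w R)) dual_pairing_form"
      by (rule pseudo_metric_dual_pairing_form[OF _ _ _ \<phi>]) unfold_locales
    show "rota_baxter_3_lie P.scale (UNIV \<times> {0}) (left_bracket br) w (left_operator R)"
      unfolding ranges
      by (rule rota_baxter_3_lie_image[OF repA.rota_baxter_3_lie_axioms P.p.vector_space_axioms emb'(1)])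
        (simp_all add: left_bracket_def left_operator_def)
    show "rota_baxter_3_lie P.scale ({0} \<times> dual_space s) (right_bracket br') w
        (right_operator (dual_operator w R))"
      unfolding ranges
      by (rule rota_baxter_3_lie_image[OF repB.rota_baxter_3_lie_axioms P.p.vector_space_axioms emb'(2)])
        (simp_all add: right_bracket_def right_operator_def)
    show "rota_baxter_subalgebra (UNIV \<times> {0}) (left_bracket br) (left_operator R)
        (UNIV \<times> dual_space s) (matched_bracket br br' (coadjoint br) \<phi>) (map_prod R (dual_operator w R))"
      by (auto simp: rota_baxter_subalgebra_def left_bracket_def left_operator_def
          matched_bracket_def zeros)
    show "rota_baxter_subalgebra ({0} \<times> dual_space s) (right_bracket br')
        (right_operator (dual_operator w R))
        (UNIV \<times> dual_space s) (matched_bracket br br' (coadjoint br) \<phi>) (map_prod R (dual_operator w R))"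
      by (auto simp: rota_baxter_subalgebra_def right_bracket_def right_operator_def
          matched_bracket_def zeros)
    show "direct_sum_decomp (UNIV \<times> dual_space s) (UNIV \<times> {0}) ({0} \<times> dual_space s)"
      by (auto simp: direct_sum_decomp_def zero_prod_def)
  next
    fix p q r :: "'a \<times> ('a \<Rightarrow> 'k)"
    assume "p \<in> UNIV \<times> {0}" "q \<in> UNIV \<times> {0}" "r \<in> {0} \<times> dual_space s"
    then obtain x y a where eq: "p = (x, 0)" "q = (y, 0)" "r = (0, a)" and a: "a \<in> dual_space s"
      by auto
    have "matched_bracket br br' (coadjoint br) \<phi> p q r = (0, coadjoint br x y a)"
      using a by (simp add: eq matched_bracket_def zeros)
    moreover have "coadjoint br x y a \<in> dual_space s"
      using a by simp
    ultimately show "proj_along (UNIV \<times> {0}) ({0} \<times> dual_space s)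
        (matched_bracket br br' (coadjoint br) \<phi> p q r) = 0"
      by (simp add: proj_along_fst zero_prod_def)
  next
    fix p q r :: "'a \<times> ('a \<Rightarrow> 'k)"
    assume "p \<in> {0} \<times> dual_space s" "q \<in> {0} \<times> dual_space s" "r \<in> UNIV \<times> {0}"
    then obtain a b x where eq: "p = (0, a)" "q = (0, b)" "r = (x, 0)"
      and ab: "a \<in> dual_space s" "b \<in> dual_space s"
      by auto
    have "matched_bracket br br' (coadjoint br) \<phi> p q r = (\<phi> a b x, 0)"
      using ab by (simp add: eq matched_bracket_def zeros)
    then show "proj_along ({0} \<times> dual_space s) (UNIV \<times> {0})
        (matched_bracket br br' (coadjoint br) \<phi> p q r) = 0"
      by (simp add: proj_along_snd zero_prod_def)
  qed
qed

text \<open>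
  Here \<open>\<phi>\<close> is read off from the bracket of the triple, because in infinite dimension \<open>br'\<close> alone
  determines a coadjoint map on the double dual of \<open>A\<close>, which need not preserve \<open>A\<close>.
\<close>
lemma matched_pair_of_manin_triple:
  fixes s :: "'k::field \<Rightarrow> 'a::ab_group_add \<Rightarrow> 'a"
  assumes "rota_baxter_3_lie s UNIV br w R"
    and "rota_baxter_3_lie fun_scale (dual_space s) br' w (dual_operator w R)"
    and manin: "manin_triple (module_prod.scale s fun_scale) w
      (UNIV \<times> dual_space s) brD RD dual_pairing_form
      (UNIV \<times> {0}) (left_bracket br) (left_operator R)
      ({0} \<times> dual_space s) (right_bracket br') (right_operator (dual_operator w R))"
  defines "\<phi> \<equiv> \<lambda>a b x. fst (brD (0, a) (0, b) (x, 0))"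
  shows "coadjoint_on_predual s br' \<phi>"
    and "matched_pair_rota_baxter s UNIV br fun_scale (dual_space s) br'
      w R (dual_operator w R) (coadjoint br) \<phi>"
proof -
  interpret A: rota_baxter_3_lie s UNIV br w R by (rule assms(1))
  interpret A': rota_baxter_3_lie fun_scale "dual_space s" br' w "dual_operator w R" by (rule assms(2))
  interpret P: vector_space_prod s "fun_scale :: 'k \<Rightarrow> ('a \<Rightarrow> 'k) \<Rightarrow> 'a \<Rightarrow> 'k" by unfold_locales
  have rb: "rota_baxter_3_lie P.scale (UNIV \<times> dual_space s) brD w RD"
    and pm: "pseudo_metric_form P.scale (UNIV \<times> dual_space s) brD w RD dual_pairing_form"
    and sub: "rota_baxter_subalgebra (UNIV \<times> {0}) (left_bracket br) (left_operator R)
        (UNIV \<times> dual_space s) brD RD"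
      "rota_baxter_subalgebra ({0} \<times> dual_space s) (right_bracket br')
        (right_operator (dual_operator w R)) (UNIV \<times> dual_space s) brD RD"
    and proj: "\<And>p q r. p \<in> UNIV \<times> {0} \<Longrightarrow> q \<in> UNIV \<times> {0} \<Longrightarrow> r \<in> {0} \<times> dual_space s \<Longrightarrow>
        proj_along (UNIV \<times> {0}) ({0} \<times> dual_space s) (brD p q r) = 0"
      "\<And>p q r. p \<in> {0} \<times> dual_space s \<Longrightarrow> q \<in> {0} \<times> dual_space s \<Longrightarrow> r \<in> UNIV \<times> {0} \<Longrightarrow>
        proj_along ({0} \<times> dual_space s) (UNIV \<times> {0}) (brD p q r) = 0"
    using manin unfolding manin_triple_def by blast+
  interpret D: rota_baxter_3_lie P.scale "UNIV \<times> dual_space s" brD w RD by (rule rb)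
  have inv: "dual_pairing_form (brD p q r) t = - dual_pairing_form (brD p q t) r"
    if "p \<in> UNIV \<times> dual_space s" "q \<in> UNIV \<times> dual_space s"
      "r \<in> UNIV \<times> dual_space s" "t \<in> UNIV \<times> dual_space s" for p q r t
  proof -
    have "dual_pairing_form (brD p q r) t + dual_pairing_form (brD p q t) r = 0"
      using pm that unfolding pseudo_metric_form_def by blast
    then show ?thesis by (simp add: eq_neg_iff_add_eq_0)
  qed
  have brA: "brD (x, 0) (y, 0) (z, 0) = (br x y z, 0)" for x y z
    using sub(1) by (simp add: rota_baxter_subalgebra_def left_bracket_def)
  have RA: "RD (x, 0) = (R x, 0)" for x
    using sub(1) by (simp add: rota_baxter_subalgebra_def left_operator_def)
  have brA': "brD (0, a) (0, b) (0, c) = (0, br' a b c)"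
    if "a \<in> dual_space s" "b \<in> dual_space s" "c \<in> dual_space s" for a b c
    using sub(2) that by (simp add: rota_baxter_subalgebra_def right_bracket_def)
  have RA': "RD (0, a) = (0, dual_operator w R a)" if "a \<in> dual_space s" for a
    using sub(2) that by (simp add: rota_baxter_subalgebra_def right_operator_def)
  have mixed: "brD (x, 0) (y, 0) (0, a) = (0, coadjoint br x y a)"
    and coadjoint_closed: "coadjoint br x y a \<in> dual_space s"
    if a: "a \<in> dual_space s" for x y a
  proof -
    have "brD (x, 0) (y, 0) (0, a) \<in> UNIV \<times> dual_space s"
      using a by (intro D.bracket_closed) simp_all
    then obtain u b where ub: "brD (x, 0) (y, 0) (0, a) = (u, b)" "b \<in> dual_space s"
      by (rule SigmaE)
    have "u = 0"
      using proj(1)[of "(x, 0)" "(y, 0)" "(0, a)"] a ub by (simp add: proj_along_fst zero_prod_def)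
    have "b z = - a (br x y z)" for z
      using inv[of "(x, 0)" "(y, 0)" "(0, a)" "(z, 0)"] a ub
      by (simp add: brA dual_pairing_form_def)
    then have "b = coadjoint br x y a"
      by (simp add: coadjoint_def fun_eq_iff)
    with \<open>u = 0\<close> show "brD (x, 0) (y, 0) (0, a) = (0, coadjoint br x y a)"
      "coadjoint br x y a \<in> dual_space s"
      using ub by simp_all
  qed
  have mixed': "brD (0, a) (0, b) (x, 0) = (\<phi> a b x, 0)"
    if ab: "a \<in> dual_space s" "b \<in> dual_space s" for a b x
  proof -
    have "brD (0, a) (0, b) (x, 0) \<in> UNIV \<times> dual_space s"
      using ab by (intro D.bracket_closed) simp_all
    then obtain u c where uc: "brD (0, a) (0, b) (x, 0) = (u, c)" "c \<in> dual_space s"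
      by (rule SigmaE)
    then show ?thesis
      using proj(2)[of "(0, a)" "(0, b)" "(x, 0)"] ab by (simp add: proj_along_snd zero_prod_def \<phi>_def)
  qed
  show "coadjoint_on_predual s br' \<phi>"
    unfolding coadjoint_on_predual_def
  proof (intro ballI allI)
    fix a b c x assume abc: "a \<in> dual_space s" "b \<in> dual_space s" "c \<in> dual_space s"
    then show "c (\<phi> a b x) = - br' a b c x"
      using inv[of "(0, a)" "(0, b)" "(x, 0)" "(0, c)"]
      by (simp add: mixed' brA' dual_pairing_form_def)
  qed
  have brD_eq: "matched_bracket br br' (coadjoint br) \<phi> p q r = brD p q r"
    if pqr: "p \<in> UNIV \<times> dual_space s" "q \<in> UNIV \<times> dual_space s" "r \<in> UNIV \<times> dual_space s" for p q r
  proof -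
    obtain x y z a b c where eq: "p = (x, a)" "q = (y, b)" "r = (z, c)"
      and abc: "a \<in> dual_space s" "b \<in> dual_space s" "c \<in> dual_space s"
      using pqr by auto
    show ?thesis
      using D.bracket_expand[of "(x, 0)" "(y, 0)" "(z, 0)" "(0, a)" "(0, b)" "(0, c)"] abc
      by (simp add: eq matched_bracket_def brA brA' mixed mixed' add.assoc)
  qed
  note emb = linear_map_on_pair_embedding[OF P.vector_space_pair_axioms
      A.subspace_carrier A'.subspace_carrier]
  have "rota_baxter_representation s UNIV br w R fun_scale (dual_space s) (coadjoint br)
      (dual_operator w R)"
    by (rule rota_baxter_representation_restrict[OF assms(1) rb A'.vector_space_axioms
        A'.subspace_carrier emb])
      (auto simp: inj_on_def brA coadjoint_closed mixed RA RA')
  moreover have "rota_baxter_representation fun_scale (dual_space s) br' w (dual_operator w R)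
      s UNIV \<phi> R"
    by (rule rota_baxter_representation_restrict[OF assms(2) rb A.vector_space_axioms
        A.subspace_carrier emb(2,1)])
      (auto simp: inj_on_def brA' mixed' RA RA')
  moreover have "three_lie_algebra P.scale (UNIV \<times> dual_space s)
      (matched_bracket br br' (coadjoint br) \<phi>)"
    by (rule three_lie_algebra_cong[OF D.three_lie_algebra_axioms brD_eq])
  ultimately show "matched_pair_rota_baxter s UNIV br fun_scale (dual_space s) br'
      w R (dual_operator w R) (coadjoint br) \<phi>"
    by (simp add: matched_pair_rota_baxter_def matched_pair_3_lie_def
        matched_pair_3_lie_axioms_def rota_baxter_representation_def)
qed

theorem proposition2p13:
  fixes s :: "'k::field \<Rightarrow> 'a::ab_group_add \<Rightarrow> 'a"
    and br :: "'a \<Rightarrow> 'a \<Rightarrow> 'a \<Rightarrow> 'a"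
    and br' :: "('a \<Rightarrow> 'k) \<Rightarrow> ('a \<Rightarrow> 'k) \<Rightarrow> ('a \<Rightarrow> 'k) \<Rightarrow> 'a \<Rightarrow> 'k"
    and w :: 'k and R :: "'a \<Rightarrow> 'a"
  assumes "vector_space s"
    and "rota_baxter_3_lie s UNIV br w R"
    and "rota_baxter_3_lie fun_scale (dual_space s) br' w (dual_operator w R)"
  shows
    "(\<exists>brD RD.
        manin_triple (module_prod.scale s fun_scale) w
          (UNIV \<times> dual_space s) brD RD dual_pairing_form
          (UNIV \<times> {0}) (left_bracket br) (left_operator R)
          ({0} \<times> dual_space s) (right_bracket br') (right_operator (dual_operator w R)))
     \<longleftrightarrow>
     (\<exists>\<phi>. coadjoint_on_predual s br' \<phi> \<and>
        matched_pair_rota_baxter s UNIV br fun_scale (dual_space s) br'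
          w R (dual_operator w R) (coadjoint br) \<phi>)"
  using matched_pair_of_manin_triple[OF assms(2,3)] manin_triple_of_matched_pair by blast

end
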